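(* Let $\mathbb{K}\in\{\mathbb{R},\mathbb{C}\}$, let $\Lambda$ be a $\sigma$-compact topological space and let $\mathfrak{B}\subset\mathbb{K}^\Lambda$ be an admissible Banach space. Suppose that $\mathfrak{K}\subset\mathfrak{B}$ is strongly equicontinuous. Then $\mathfrak{K}$ is relatively compact in $\mathfrak{B}$ if and only if both of the following hold: (RC1) $\mathfrak{K}$ is bounded in $\mathfrak{B}$; (RC2) for every $\varepsilon>0$ there exists a compact set $\Lambda_\varepsilon\subset\Lambda$ such that $$\sup_{w\in\mathfrak{K}}\|w\,\chi_{\Lambda\setminus\Lambda_\varepsilon}\|_{\mathfrak{B}}\le\varepsilon.$$
   Context: For $S\subset\Lambda$, $\chi_S$ is the indicator function of $S$; products and absolute values in $\mathbb{K}^\Lambda$ are pointwise. A set is relatively compact if its closure is compact. Admissible Banach space. Let $\Lambda$ be a $\sigma$-compact topological space. A Banach space $\mathfrak{B}\subset\mathbb{K}^\Lambda$ over $\mathbb{K}$ is admissible if (with the convention $\|w\|_{\mathfrak{B}}=\infty$ for $w\in\mathbb{K}^\Lambda\setminus\mathfrak{B}$): (i) $\|\chi_{\Lambda'}\|_{\mathfrak{B}}<\infty$ for every compact $\Lambda'\subset\Lambda$; (ii) $\mathfrak{B}$ is solid: $\|w\|_{\mathfrak{B}}=\||w|\|_{\mathfrak{B}}\le\|z\|_{\mathfrak{B}}$ for all $z\in\mathfrak{B}$ and $w$ with $|z(\lambda)|\ge|w(\lambda)|$ for all $\lambda\in\Lambda$; (iii) the elements of $\mathfrak{B}$ with compact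 support are dense in $\mathfrak{B}$. Strong equicontinuity. $\mathfrak{K}\subset\mathfrak{B}$ is strongly equicontinuous if for all $\varepsilon>0$ and all $\lambda\in\Lambda$ there exists an open set $U_\varepsilon(\lambda)\subset\Lambda$ containing $\lambda$ such that $\sup_{w\in\mathfrak{K}}|w(\mu)-w(\lambda)|\le\varepsilon$ for all $\mu\in U_\varepsilon(\lambda)$. *)

theory Defs
  imports "HOL-Analysis.Analysis"
begin

definition sigma_compact :: "'l::topological_space set \<Rightarrow> bool" where
  "sigma_compact S \<longleftrightarrow> (\<exists>C :: nat \<Rightarrow> 'l set. (\<forall>n. compact (C n)) \<and> S = (\<Union>n. C n))"

text \<open>
  The vector space \<open>B\<close> is a set of functions, and the values of \<open>nrm\<close> outside \<open>B\<close> play no role.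
  The scalar field is the type \<open>'k\<close>, meant to be instantiated with the reals or the complex numbers.
\<close>

locale normed_function_space =
  fixes B :: "('l \<Rightarrow> 'k::real_normed_field) set" and nrm :: "('l \<Rightarrow> 'k) \<Rightarrow> real"
  assumes zero_mem: "(\<lambda>_. 0) \<in> B"
    and add_mem: "\<lbrakk>w \<in> B; z \<in> B\<rbrakk> \<Longrightarrow> (\<lambda>x. w x + z x) \<in> B"
    and scale_mem: "w \<in> B \<Longrightarrow> (\<lambda>x. c * w x) \<in> B"
    and nrm_eq_0_iff: "w \<in> B \<Longrightarrow> nrm w = 0 \<longleftrightarrow> w = (\<lambda>_. 0)"
    and nrm_triangle: "\<lbrakk>w \<in> B; z \<in> B\<rbrakk> \<Longrightarrow> nrm (\<lambda>x. w x + z x) \<le> nrm w + nrm z"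
    and nrm_scale: "w \<in> B \<Longrightarrow> nrm (\<lambda>x. c * w x) = norm c * nrm w"
begin

text \<open>
  Nonnegativity and symmetry of the distance are required on the whole type by the locale
  \<open>Metric_space\<close>, hence the default value outside \<open>B\<close>.
\<close>

definition nrm_dist :: "('l \<Rightarrow> 'k) \<Rightarrow> ('l \<Rightarrow> 'k) \<Rightarrow> real" where
  "nrm_dist w z = (if w \<in> B \<and> z \<in> B then nrm (\<lambda>x. w x - z x) else 0)"

text \<open>The norm of a function outside \<open>B\<close> is infinite by convention.\<close>

definition enrm :: "('l \<Rightarrow> 'k) \<Rightarrow> ennreal" where
  "enrm w = (if w \<in> B then ennreal (nrm w) else \<infinity>)"

lemma minus_mem: "(\<lambda>x. w x - z x) \<in> B" if "w \<in> B" "z \<in> B"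
  using add_mem[OF that(1) scale_mem[OF that(2), of "-1"]] by simp

lemma nrm_minus_commute: "nrm (\<lambda>x. w x - z x) = nrm (\<lambda>x. z x - w x)" if "w \<in> B" "z \<in> B"
  using nrm_scale[OF minus_mem[OF that], of "-1"] by simp

lemma nrm_nonneg: "0 \<le> nrm w" if "w \<in> B"
proof -
  have "nrm (\<lambda>x. w x + (-1) * w x) \<le> nrm w + nrm (\<lambda>x. (-1) * w x)"
    by (rule nrm_triangle[OF that scale_mem[OF that]])
  moreover have "nrm (\<lambda>x. w x + (-1) * w x) = 0"
    using nrm_eq_0_iff[OF zero_mem] by simp
  ultimately show ?thesis
    using nrm_scale[OF that, of "-1"] by simp
qed

sublocale Metric_space B nrm_dist
proof
  show "0 \<le> nrm_dist w z" for w z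
    by (simp add: nrm_dist_def nrm_nonneg minus_mem)
  show "nrm_dist w z = nrm_dist z w" for w z
    using nrm_minus_commute[of w z] by (auto simp: nrm_dist_def)
  show "nrm_dist w z = 0 \<longleftrightarrow> w = z" if "w \<in> B" "z \<in> B" for w z
    using that by (auto simp: nrm_dist_def nrm_eq_0_iff minus_mem fun_eq_iff)
  show "nrm_dist u z \<le> nrm_dist u w + nrm_dist w z" if "u \<in> B" "w \<in> B" "z \<in> B" for u w z
    using nrm_triangle[OF minus_mem[OF that(1,2)] minus_mem[OF that(2,3)]] that
    by (simp add: nrm_dist_def)
qed

definition relatively_compact :: "('l \<Rightarrow> 'k) set \<Rightarrow> bool" where
  "relatively_compact \<KK> \<longleftrightarrow> compactin mtopology (mtopology closure_of \<KK>)"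

end

locale banach_function_space = normed_function_space +
  assumes complete: mcomplete

definition compactly_supported :: "('l::topological_space \<Rightarrow> 'k::zero) \<Rightarrow> bool" where
  "compactly_supported w \<longleftrightarrow> compact (closure {x. w x \<noteq> 0})"

locale admissible_banach_space = banach_function_space B nrm
  for B :: "('l::topological_space \<Rightarrow> 'k::real_normed_field) set" and nrm +
  assumes indicator_finite: "compact L \<Longrightarrow> enrm (indicator L) < \<infinity>"
    and solid: "\<lbrakk>z \<in> B; \<And>x. norm (w x) \<le> norm (z x)\<rbrakk> \<Longrightarrow>
      enrm w = enrm (\<lambda>x. of_real (norm (w x))) \<and> enrm (\<lambda>x. of_real (norm (w x))) \<le> enrm z"
    and compactly_supported_dense: "mtopology closure_of {w \<in> B. compactly_supported w} = B"

definition strongly_equicontinuous :: "('l::topological_space \<Rightarrow> 'k::real_normed_field) set \<Rightarrow> bool" where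
  "strongly_equicontinuous \<KK> \<longleftrightarrow>
    (\<forall>\<epsilon>>0. \<forall>x. \<exists>U. open U \<and> x \<in> U \<and>
      (\<forall>y\<in>U. (SUP w\<in>\<KK>. ennreal (norm (w y - w x))) \<le> ennreal \<epsilon>))"

end

theory Submission
  imports Defs
begin

text \<open>
  As the space is complete, relative compactness is total boundedness, and both directions
  are about finite nets for the norm.

  If \<open>\<KK>\<close> is totally bounded, cover it by finitely many balls and move their centres slightly so that
  they have compact support. Outside the union \<open>L\<close> of these supports, an element \<open>w\<close> of the ball with
  centre \<open>z\<close> coincides with \<open>w - z\<close>, so solidity bounds the tail of \<open>w\<close> by the radius
  (\<open>mtotally_bounded_imp_uniform_tails\<close>).

  Conversely, uniformly small tails reduce the construction of a net to one compact set \<open>L\<close>. On \<open>L\<close>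
  the argument is that of Arzela and Ascoli: equicontinuity and a finite subcover reduce it further to
  the values at finitely many points, and evaluation at a point is bounded on \<open>\<KK>\<close> because solidity
  gives \<open>norm (w x) * nrm (indicator {x}) \<le> nrm w\<close>. Bounded sets of scalars being totally bounded,
  finitely many elements of \<open>\<KK>\<close> approximate all of \<open>\<KK>\<close> uniformly on \<open>L\<close>
  (\<open>finite_uniform_net_on_compact\<close>). Finally \<open>norm (w x) \<le> \<delta>\<close> on \<open>L\<close> implies
  \<open>nrm (w * indicator L) \<le> \<delta> * nrm (indicator L)\<close>, so the uniform net is a net in norm.
\<close>

section \<open>Finite nets in the uniform norm on a compact set\<close>

lemma bounded_imp_finite_net:
  fixes S :: "'a::heine_borel set"
  assumes "bounded S" and "\<delta> > 0"
  shows "\<exists>T. finite T \<and> (\<forall>s\<in>S. \<exists>t\<in>T. dist s t < \<delta>)"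
proof -
  have "compact (closure S)"
    using assms(1) by simp
  then obtain T where "finite T" "closure S \<subseteq> (\<Union>t\<in>T. ball t \<delta>)"
    using seq_compact_imp_totally_bounded[OF compact_imp_seq_compact, of "closure S"] assms(2)
    by blast
  then show ?thesis
    using closure_subset[of S] by (force simp: dist_commute intro!: exI[of _ T])
qed

text \<open>
  Sending \<open>w\<close> to a choice of net points near its values on \<open>F\<close> takes only finitely many values, and one representative is chosen for each. This avoids compactness in a product space and
  yields approximants that belong to \<open>\<KK>\<close> itself.
\<close>

lemma finite_net_at_finitely_many_points:
  fixes \<KK> :: "('l \<Rightarrow> 'k::heine_borel) set"
  assumes "finite F" and bdd: "\<And>x. x \<in> F \<Longrightarrow> bounded ((\<lambda>w. w x) ` \<KK>)" and "\<delta> > 0"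
  shows "\<exists>N. finite N \<and> N \<subseteq> \<KK> \<and> (\<forall>w\<in>\<KK>. \<exists>v\<in>N. \<forall>x\<in>F. dist (w x) (v x) < \<delta>)"
proof -
  have "\<exists>T. finite T \<and> (\<forall>w\<in>\<KK>. \<exists>t\<in>T. dist (w x) t < \<delta>/2)" if "x \<in> F" for x
    using bounded_imp_finite_net[OF bdd[OF that], of "\<delta>/2"] \<open>\<delta> > 0\<close> by simp
  then obtain T where T: "\<And>x. x \<in> F \<Longrightarrow> finite (T x)"
      and near: "\<And>x w. x \<in> F \<Longrightarrow> w \<in> \<KK> \<Longrightarrow> \<exists>t\<in>T x. dist (w x) t < \<delta>/2"
    by metis
  define c where "c w x = (SOME t. t \<in> T x \<and> dist (w x) t < \<delta>/2)" for w x
  have c: "c w x \<in> T x" "dist (w x) (c w x) < \<delta>/2" if "w \<in> \<KK>" "x \<in> F" for w x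
    using someI_ex[of "\<lambda>t. t \<in> T x \<and> dist (w x) t < \<delta>/2"] near[OF that(2,1)]
    unfolding c_def by blast+
  define code where "code w = restrict (c w) F" for w
  have "code ` \<KK> \<subseteq> Pi\<^sub>E F T"
    using c(1) by (auto simp: code_def)
  then have "finite (code ` \<KK>)"
    by (rule finite_subset) (intro finite_PiE \<open>finite F\<close> T)
  then obtain N where N: "N \<subseteq> \<KK>" "finite N" and reps: "code ` \<KK> = code ` N"
    using finite_subset_image[of "code ` \<KK>" code \<KK>] by auto
  have "\<exists>v\<in>N. \<forall>x\<in>F. dist (w x) (v x) < \<delta>" if "w \<in> \<KK>" for w
  proof -
    have "code w \<in> code ` N"
      using that reps by blast
    then obtain v where v: "v \<in> N" "code w = code v"
      by blast
    have "dist (w x) (v x) < \<delta>" if "x \<in> F" for x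
    proof (rule dist_triangle_half_l)
      show "dist (w x) (c w x) < \<delta>/2"
        using c(2) \<open>w \<in> \<KK>\<close> that by blast
      have "c w x = c v x"
        using fun_cong[OF v(2), of x] that by (simp add: code_def)
      then show "dist (v x) (c w x) < \<delta>/2"
        using c(2) v(1) N(1) that by auto
    qed
    with v(1) show ?thesis by blast
  qed
  with N show ?thesis by blast
qed

lemma strongly_equicontinuousD:
  assumes "strongly_equicontinuous \<KK>" and "\<epsilon> > 0"
  shows "\<exists>U. open U \<and> x \<in> U \<and> (\<forall>y\<in>U. \<forall>w\<in>\<KK>. norm (w y - w x) \<le> \<epsilon>)"
proof -
  obtain U where "open U" "x \<in> U"
      and "\<forall>y\<in>U. (SUP w\<in>\<KK>. ennreal (norm (w y - w x))) \<le> ennreal \<epsilon>"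
    using assms unfolding strongly_equicontinuous_def by blast
  then show ?thesis
    using \<open>\<epsilon> > 0\<close> by (auto simp: SUP_le_iff ennreal_le_iff intro!: exI[of _ U])
qed

text \<open>
  The Arzela-Ascoli argument: near one of finitely many points \<open>x\<close>, passing from \<open>y\<close> to \<open>x\<close>, from
  \<open>w\<close> to \<open>v\<close> and back from \<open>x\<close> to \<open>y\<close> costs a third of \<open>\<delta>\<close> each time.
\<close>

lemma finite_uniform_net_on_compact:
  fixes \<KK> :: "('l::topological_space \<Rightarrow> 'k::{real_normed_field,heine_borel}) set"
  assumes "strongly_equicontinuous \<KK>" and "compact L"
    and bdd: "\<And>x. bounded ((\<lambda>w. w x) ` \<KK>)" and "\<delta> > 0"
  shows "\<exists>N. finite N \<and> N \<subseteq> \<KK> \<and> (\<forall>w\<in>\<KK>. \<exists>v\<in>N. \<forall>y\<in>L. norm (w y - v y) \<le> \<delta>)"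
proof -
  have "\<delta>/3 > 0"
    using \<open>\<delta> > 0\<close> by simp
  obtain U where U: "\<And>x. open (U x)" "\<And>x. x \<in> U x"
      and osc: "\<And>x y w. y \<in> U x \<Longrightarrow> w \<in> \<KK> \<Longrightarrow> norm (w y - w x) \<le> \<delta>/3"
    using strongly_equicontinuousD[OF assms(1) \<open>\<delta>/3 > 0\<close>] by metis
  have "L \<subseteq> (\<Union>x\<in>L. U x)"
    using U(2) by blast
  then obtain F where "finite F" and cover: "L \<subseteq> (\<Union>x\<in>F. U x)"
    by (rule compactE_image[OF \<open>compact L\<close> U(1)])
  obtain N where N: "finite N" "N \<subseteq> \<KK>"
      and net: "\<And>w. w \<in> \<KK> \<Longrightarrow> \<exists>v\<in>N. \<forall>x\<in>F. dist (w x) (v x) < \<delta>/3"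
    using finite_net_at_finitely_many_points[OF \<open>finite F\<close> bdd \<open>\<delta>/3 > 0\<close>] by blast
  have "\<exists>v\<in>N. \<forall>y\<in>L. norm (w y - v y) \<le> \<delta>" if "w \<in> \<KK>" for w
  proof -
    obtain v where v: "v \<in> N" "\<forall>x\<in>F. dist (w x) (v x) < \<delta>/3"
      using net[OF \<open>w \<in> \<KK>\<close>] by blast
    have "norm (w y - v y) \<le> \<delta>" if "y \<in> L" for y
    proof -
      obtain x where "x \<in> F" "y \<in> U x"
        using cover \<open>y \<in> L\<close> by blast
      have "w y - v y = (w y - w x) + (w x - v x) - (v y - v x)"
        by simp
      then have "norm (w y - v y) \<le> norm (w y - w x) + norm (w x - v x) + norm (v y - v x)"
        using norm_triangle_ineq4[of "(w y - w x) + (w x - v x)" "v y - v x"]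
          norm_triangle_ineq[of "w y - w x" "w x - v x"] by simp
      also have "\<dots> \<le> \<delta>/3 + \<delta>/3 + \<delta>/3"
        using osc[OF \<open>y \<in> U x\<close>] v \<open>x \<in> F\<close> \<open>w \<in> \<KK>\<close> N(2)
        by (intro add_mono) (auto simp: dist_norm less_imp_le)
      finally show ?thesis by simp
    qed
    with v(1) show ?thesis by blast
  qed
  with N show ?thesis by blast
qed

section \<open>Consequences of solidity\<close>

context normed_function_space
begin

lemma nrm_diff_le: "nrm (\<lambda>x. w x - z x) \<le> nrm w + nrm z" if "w \<in> B" "z \<in> B"
  using nrm_triangle[OF that(1) scale_mem[OF that(2), of "-1"]] nrm_scale[OF that(2), of "-1"]
  by simp

lemma mbounded_imp_nrm_bounded:
  assumes "mbounded \<KK>"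
  shows "\<exists>C. \<forall>w\<in>\<KK>. nrm w \<le> C"
proof -
  obtain z C where zC: "\<KK> \<subseteq> mcball z C"
    using assms unfolding mbounded_def by blast
  have "nrm w \<le> C + nrm z" if "w \<in> \<KK>" for w
  proof -
    have "z \<in> B" "w \<in> B" "nrm_dist z w \<le> C"
      using zC that by auto
    then show ?thesis
      using nrm_triangle[OF minus_mem[of w z] \<open>z \<in> B\<close>] nrm_minus_commute[of z w]
      by (simp add: nrm_dist_def)
  qed
  then show ?thesis by blast
qed

end

context admissible_banach_space
begin

lemma solid_mem:
  assumes "z \<in> B" and "\<And>x. norm (w x) \<le> norm (z x)"
  shows "w \<in> B"
proof -
  have "enrm w \<le> enrm z"
    using solid[OF assms] by metis
  then show ?thesis
    using assms(1) by (auto simp: enrm_def top_unique split: if_splits)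
qed

lemma solid_nrm_le:
  assumes "z \<in> B" and "\<And>x. norm (w x) \<le> norm (z x)"
  shows "nrm w \<le> nrm z"
proof -
  have "enrm w \<le> enrm z"
    using solid[OF assms] by metis
  then show ?thesis
    using assms(1) solid_mem[OF assms] by (simp add: enrm_def ennreal_le_iff nrm_nonneg)
qed

lemma indicator_mem: "indicator L \<in> B" if "compact L"
  using indicator_finite[OF that] by (auto simp: enrm_def split: if_splits)

lemma mult_indicator_mem: "(\<lambda>x. w x * indicator S x) \<in> B" if "w \<in> B"
  by (rule solid_mem[OF that]) (simp add: indicator_def)

lemma tail_bound_iff:
  assumes "\<KK> \<subseteq> B" and "\<epsilon> > 0"
  shows "(SUP w\<in>\<KK>. enrm (\<lambda>x. w x * indicator S x)) \<le> ennreal \<epsilon> \<longleftrightarrow>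
    (\<forall>w\<in>\<KK>. nrm (\<lambda>x. w x * indicator S x) \<le> \<epsilon>)"
proof -
  have "enrm (\<lambda>x. w x * indicator S x) \<le> ennreal \<epsilon> \<longleftrightarrow> nrm (\<lambda>x. w x * indicator S x) \<le> \<epsilon>"
    if "w \<in> \<KK>" for w
  proof -
    have "(\<lambda>x. w x * indicator S x) \<in> B"
      using mult_indicator_mem assms(1) that by blast
    then show ?thesis
      using assms(2) by (simp add: enrm_def ennreal_le_iff)
  qed
  then show ?thesis
    by (simp add: SUP_le_iff)
qed

text \<open>
  Singletons are compact, so their indicators have finite norm, and a nonzero one; this makes point
  evaluations continuous.
\<close>

lemma pointwise_bounded:
  assumes "\<KK> \<subseteq> B" and C: "\<forall>w\<in>\<KK>. nrm w \<le> C"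
  shows "bounded ((\<lambda>w. w x) ` \<KK>)"
proof -
  let ?e = "indicator {x} :: 'l \<Rightarrow> 'k"
  have e: "?e \<in> B"
    by (simp add: indicator_mem)
  have "?e \<noteq> (\<lambda>_. 0)"
    by (metis indicator_simps(1) singletonI zero_neq_one)
  then have pos: "nrm ?e > 0"
    using nrm_eq_0_iff[OF e] nrm_nonneg[OF e] by simp
  have "norm (w x) \<le> C / nrm ?e" if "w \<in> \<KK>" for w
  proof -
    have "norm (w x) * nrm ?e = nrm (\<lambda>y. w x * ?e y)"
      using nrm_scale[OF e] by simp
    also have "\<dots> \<le> nrm w"
      using that assms(1) by (intro solid_nrm_le) (auto simp: indicator_def)
    also have "\<dots> \<le> C"
      using C that by blast
    finally show ?thesis
      using pos by (simp add: pos_le_divide_eq)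
  qed
  then show ?thesis
    unfolding bounded_iff by blast
qed

section \<open>Total boundedness and uniform tails\<close>

lemma exists_compactly_supported_near:
  assumes "w \<in> B" and "\<epsilon> > 0"
  shows "\<exists>z\<in>B. compactly_supported z \<and> nrm_dist w z < \<epsilon>"
proof -
  have "w \<in> mtopology closure_of {z \<in> B. compactly_supported z}"
    using compactly_supported_dense assms(1) by simp
  then show ?thesis
    using assms(2) by (auto simp: metric_closure_of)
qed

text \<open>
  A single compactly supported \<open>z\<close> near \<open>w\<close> gives a compact set that works for all elements near \<open>w\<close>,
  since off the support of \<open>z\<close> solidity compares such an element with its difference from \<open>z\<close>. A finite
  net therefore needs only a finite union of supports.
\<close>

lemma mtotally_bounded_imp_uniform_tails:
  assumes tb: "mtotally_bounded \<KK>" and "\<epsilon> > 0"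
  shows "\<exists>L. compact L \<and> (\<forall>w\<in>\<KK>. nrm (\<lambda>x. w x * indicator (- L) x) \<le> \<epsilon>)"
proof -
  have "\<epsilon>/2 > 0"
    using \<open>\<epsilon> > 0\<close> by simp
  obtain N where "finite N" "N \<subseteq> \<KK>" and net: "\<KK> \<subseteq> (\<Union>v\<in>N. mball v (\<epsilon>/2))"
    using tb[unfolded mtotally_bounded_def, rule_format, OF \<open>\<epsilon>/2 > 0\<close>] by metis
  have "N \<subseteq> B"
    using \<open>N \<subseteq> \<KK>\<close> mtotally_bounded_imp_subset[OF tb] by blast
  then have "\<forall>v\<in>N. \<exists>z. z \<in> B \<and> compactly_supported z \<and> nrm_dist v z < \<epsilon>/2"
    using exists_compactly_supported_near[OF _ \<open>\<epsilon>/2 > 0\<close>] by blast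
  then obtain Z where Z: "\<And>v. v \<in> N \<Longrightarrow> Z v \<in> B \<and> compactly_supported (Z v) \<and> nrm_dist v (Z v) < \<epsilon>/2"
    unfolding bchoice_iff by blast
  define L where "L = (\<Union>v\<in>N. closure {x. Z v x \<noteq> 0})"
  have "compact L"
    using Z \<open>finite N\<close> unfolding L_def compactly_supported_def by (intro compact_UN) auto
  moreover have "nrm (\<lambda>x. w x * indicator (- L) x) \<le> \<epsilon>" if "w \<in> \<KK>" for w
  proof -
    have "w \<in> (\<Union>v\<in>N. mball v (\<epsilon>/2))"
      using net that by (rule subsetD)
    then obtain v where v: "v \<in> N" "w \<in> B" "v \<in> B" "nrm_dist v w < \<epsilon>/2"
      by auto
    have "Z v x = 0" if "x \<notin> L" for x
      using that v(1) closure_subset[of "{x. Z v x \<noteq> 0}"] unfolding L_def by blast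
    then have "norm (w x * indicator (- L) x) \<le> norm (w x - Z v x)" for x
      by (cases "x \<in> L") auto
    then have "nrm (\<lambda>x. w x * indicator (- L) x) \<le> nrm (\<lambda>x. w x - Z v x)"
      using Z[OF v(1)] v(2) by (intro solid_nrm_le minus_mem) auto
    also have "\<dots> = nrm_dist w (Z v)"
      using Z[OF v(1)] v(2) by (simp add: nrm_dist_def)
    also have "\<dots> \<le> nrm_dist w v + nrm_dist v (Z v)"
      using Z[OF v(1)] v by (intro triangle) auto
    also have "\<dots> \<le> \<epsilon>"
      using Z[OF v(1)] v(4) commute[of v w] by simp
    finally show ?thesis .
  qed
  ultimately show ?thesis by blast
qed

text \<open>Solidity turns a uniform bound on a compact set into a bound in norm.\<close>

lemma nrm_restrict_le:
  assumes "w \<in> B" and "compact L" and "\<delta> \<ge> 0" and le: "\<And>x. x \<in> L \<Longrightarrow> norm (w x) \<le> \<delta>"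
  shows "nrm (\<lambda>x. w x * indicator L x) \<le> \<delta> * nrm (indicator L)"
proof -
  have "nrm (\<lambda>x. w x * indicator L x) \<le> nrm (\<lambda>x. of_real \<delta> * indicator L x)"
    using le \<open>\<delta> \<ge> 0\<close>
    by (intro solid_nrm_le scale_mem indicator_mem[OF \<open>compact L\<close>]) (auto simp: indicator_def)
  also have "\<dots> = \<delta> * nrm (indicator L)"
    using nrm_scale[OF indicator_mem[OF \<open>compact L\<close>]] \<open>\<delta> \<ge> 0\<close> by simp
  finally show ?thesis .
qed

lemma nrm_diff_le_restrict_plus_tails:
  assumes "w \<in> B" and "v \<in> B"
  shows "nrm (\<lambda>x. w x - v x) \<le> nrm (\<lambda>x. (w x - v x) * indicator L x)
    + (nrm (\<lambda>x. w x * indicator (- L) x) + nrm (\<lambda>x. v x * indicator (- L) x))"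
proof -
  let ?tail = "\<lambda>u x. u x * indicator (- L) x :: 'k"
  have tails: "?tail w \<in> B" "?tail v \<in> B"
    using assms by (simp_all add: mult_indicator_mem)
  have "(\<lambda>x. w x - v x) = (\<lambda>x. (w x - v x) * indicator L x + (?tail w x - ?tail v x))"
    by (auto simp: indicator_def)
  then have "nrm (\<lambda>x. w x - v x)
      \<le> nrm (\<lambda>x. (w x - v x) * indicator L x) + nrm (\<lambda>x. ?tail w x - ?tail v x)"
    using nrm_triangle[OF mult_indicator_mem[OF minus_mem[OF assms]] minus_mem[OF tails], of L]
    by simp
  then show ?thesis
    using nrm_diff_le[OF tails] by simp
qed

end

lemma equicontinuous_uniform_tails_imp_mtotally_bounded:
  fixes B :: "('l::topological_space \<Rightarrow> 'k::{real_normed_field,heine_borel}) set"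
  assumes "admissible_banach_space B nrm" and sub: "\<KK> \<subseteq> B" and equi: "strongly_equicontinuous \<KK>"
    and bdd: "\<forall>w\<in>\<KK>. nrm w \<le> C"
    and tails: "\<And>\<epsilon>. \<epsilon> > 0 \<Longrightarrow>
      \<exists>L. compact L \<and> (\<forall>w\<in>\<KK>. nrm (\<lambda>x. w x * indicator (- L) x) \<le> \<epsilon>)"
  shows "Metric_space.mtotally_bounded B (normed_function_space.nrm_dist B nrm) \<KK>"
proof -
  interpret admissible_banach_space B nrm by fact
  have "\<exists>N. finite N \<and> N \<subseteq> \<KK> \<and> \<KK> \<subseteq> (\<Union>v\<in>N. mball v \<epsilon>)" if "\<epsilon> > 0" for \<epsilon>
  proof -
    obtain L where "compact L" and tail: "\<And>w. w \<in> \<KK> \<Longrightarrow> nrm (\<lambda>x. w x * indicator (- L) x) \<le> \<epsilon>/4"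
      using tails[of "\<epsilon>/4"] \<open>\<epsilon> > 0\<close> by auto
    define M where "M = nrm (indicator L)"
    have "M \<ge> 0"
      unfolding M_def by (intro nrm_nonneg indicator_mem \<open>compact L\<close>)
    \<comment> \<open>The summand 1 keeps \<open>\<delta>\<close> defined when \<open>M\<close> vanishes and makes the inequality strict.\<close>
    define \<delta> where "\<delta> = \<epsilon> / (2 * (M + 1))"
    have "\<delta> > 0" and \<delta>M: "\<delta> * M < \<epsilon>/2"
      using \<open>\<epsilon> > 0\<close> \<open>M \<ge> 0\<close> by (simp_all add: \<delta>_def field_simps)
    obtain N where N: "finite N" "N \<subseteq> \<KK>"
        and net: "\<And>w. w \<in> \<KK> \<Longrightarrow> \<exists>v\<in>N. \<forall>y\<in>L. norm (w y - v y) \<le> \<delta>"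
      using finite_uniform_net_on_compact[OF equi \<open>compact L\<close> pointwise_bounded[OF sub bdd] \<open>\<delta> > 0\<close>]
      by blast
    have "w \<in> (\<Union>v\<in>N. mball v \<epsilon>)" if "w \<in> \<KK>" for w
    proof -
      obtain v where v: "v \<in> N" "\<forall>y\<in>L. norm (w y - v y) \<le> \<delta>"
        using net[OF \<open>w \<in> \<KK>\<close>] by blast
      have mem: "w \<in> B" "v \<in> B" and "v \<in> \<KK>"
        using \<open>w \<in> \<KK>\<close> v(1) N(2) sub by auto
      have "nrm (\<lambda>x. (w x - v x) * indicator L x) \<le> \<delta> * M"
        unfolding M_def
        using v(2) \<open>\<delta> > 0\<close> by (intro nrm_restrict_le minus_mem mem \<open>compact L\<close>) auto
      then have "nrm (\<lambda>x. w x - v x) < \<epsilon>"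
        using nrm_diff_le_restrict_plus_tails[OF mem, of L] tail[OF \<open>w \<in> \<KK>\<close>] tail[OF \<open>v \<in> \<KK>\<close>] \<delta>M
        by linarith
      then have "w \<in> mball v \<epsilon>"
        using mem nrm_minus_commute[OF mem] by (simp add: nrm_dist_def)
      with v(1) show ?thesis by blast
    qed
    then have "\<KK> \<subseteq> (\<Union>v\<in>N. mball v \<epsilon>)"
      by (rule subsetI)
    with N show ?thesis by (intro exI[of _ N] conjI)
  qed
  then show ?thesis
    by (simp add: mtotally_bounded_def)
qed

text \<open>
  The class \<open>heine_borel\<close> covers the real and the complex scalars at once; it supplies
  the total boundedness of bounded sets of values.
\<close>

lemma relatively_compact_iff_bounded_uniform_tails:
  fixes B :: "('l::topological_space \<Rightarrow> 'k::{real_normed_field,heine_borel}) set"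
  assumes "admissible_banach_space B nrm" and sub: "\<KK> \<subseteq> B" and "strongly_equicontinuous \<KK>"
  shows "normed_function_space.relatively_compact B nrm \<KK> \<longleftrightarrow>
    (\<exists>C. \<forall>w\<in>\<KK>. nrm w \<le> C) \<and>
    (\<forall>\<epsilon>>0. \<exists>L. compact L \<and>
      (SUP w\<in>\<KK>. normed_function_space.enrm B nrm (\<lambda>x. w x * indicator (- L) x)) \<le> ennreal \<epsilon>)"
proof -
  interpret admissible_banach_space B nrm by fact
  have "relatively_compact \<KK> \<longleftrightarrow> mtotally_bounded \<KK>"
    using mtotally_bounded_eq_compact_closure_of[OF complete] sub
    by (simp add: relatively_compact_def)
  also have "\<dots> \<longleftrightarrow> (\<exists>C. \<forall>w\<in>\<KK>. nrm w \<le> C) \<and>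
      (\<forall>\<epsilon>>0. \<exists>L. compact L \<and> (\<forall>w\<in>\<KK>. nrm (\<lambda>x. w x * indicator (- L) x) \<le> \<epsilon>))"
    (is "_ \<longleftrightarrow> ?bdd \<and> ?tails")
  proof (intro iffI conjI)
    assume tb: "mtotally_bounded \<KK>"
    show ?bdd
      by (intro mbounded_imp_nrm_bounded mtotally_bounded_imp_mbounded tb)
    show ?tails
      by (intro allI impI mtotally_bounded_imp_uniform_tails tb)
  next
    assume "?bdd \<and> ?tails"
    then obtain C where "\<forall>w\<in>\<KK>. nrm w \<le> C" and ?tails
      by blast
    then show "mtotally_bounded \<KK>"
      by (intro equicontinuous_uniform_tails_imp_mtotally_bounded[OF assms]) simp_all
  qed
  also have "\<dots> \<longleftrightarrow> (\<exists>C. \<forall>w\<in>\<KK>. nrm w \<le> C) \<and>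
      (\<forall>\<epsilon>>0. \<exists>L. compact L \<and>
        (SUP w\<in>\<KK>. enrm (\<lambda>x. w x * indicator (- L) x)) \<le> ennreal \<epsilon>)"
    using tail_bound_iff[OF sub] by simp
  finally show ?thesis .
qed

theorem theoremA3:
  assumes "sigma_compact (UNIV :: 'l::topological_space set)"
  shows "(\<forall>(B :: ('l \<Rightarrow> real) set) nrm \<KK>.
      admissible_banach_space B nrm \<and> \<KK> \<subseteq> B \<and> strongly_equicontinuous \<KK> \<longrightarrow>
      (normed_function_space.relatively_compact B nrm \<KK> \<longleftrightarrow>
        (\<exists>C. \<forall>w\<in>\<KK>. nrm w \<le> C) \<and>
        (\<forall>\<epsilon>>0. \<exists>L. compact L \<and>
          (SUP w\<in>\<KK>. normed_function_space.enrm B nrm (\<lambda>x. w x * indicator (- L) x)) \<le> ennreal \<epsilon>)))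
    \<and> (\<forall>(B :: ('l \<Rightarrow> complex) set) nrm \<KK>.
      admissible_banach_space B nrm \<and> \<KK> \<subseteq> B \<and> strongly_equicontinuous \<KK> \<longrightarrow>
      (normed_function_space.relatively_compact B nrm \<KK> \<longleftrightarrow>
        (\<exists>C. \<forall>w\<in>\<KK>. nrm w \<le> C) \<and>
        (\<forall>\<epsilon>>0. \<exists>L. compact L \<and>
          (SUP w\<in>\<KK>. normed_function_space.enrm B nrm (\<lambda>x. w x * indicator (- L) x)) \<le> ennreal \<epsilon>)))"
  by (intro conjI allI impI; elim conjE; rule relatively_compact_iff_bounded_uniform_tails)

end
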